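(* Let $k\ge 1$ and $p_{\mathrm{FA}}\in(0,1)$. Consider testing, from a single observation $Y\in\mathbb{R}^k$, the hypothesis $\mathcal{H}_0: Y\sim\mathcal{N}_k(0,I)$ against $\mathcal{H}_1: Y\sim\mathcal{N}_k(\mu_1,I)$ for some unknown $\mu_1\in\mathbb{R}^k\setminus\{0\}$. Then the detector that accepts $\mathcal{H}_0$ (i.e. outputs $0$) when $$\|y\|^2< Q_{(k)}^{-1}(p_{\mathrm{FA}})$$ and outputs $1$ otherwise is a universal minimax (UMM) detector with significance level $p_{\mathrm{FA}}$.
   Context: $\mathcal{N}_k(\mu,\Sigma)$ is the $k$-dimensional normal distribution. $Q_{(k)}^{-1}$ is the inverse of the tail function $Q_{(k)}(t)=P(Z>t)$ of the (central) $\chi^2$ distribution with $k$ degrees of freedom. A detector $R$ is a (possibly randomized) statistic $R(y)\in\{0,1\}$. Its error probabilities are $p_{\mathrm{FA}}(R)=P(R(Y)=1)$ when $Y\sim\mathcal{N}_k(0,I)$, and $p_{\mathrm{MD}}(R;\mu_1)=P(R(Y)=0)$ when $Y\sim\mathcal{N}_k(\mu_1,I)$. Let $\mathcal{R}(p)=\{R: p_{\mathrm{FA}}(R)\le p\}$ and $p^*_{\mathrm{MD}}(p;\mu_1)=\min_{R\in\mathcal{R}(p)}p_{\mathrm{MD}}(R;\mu_1)$. Hardness: $\mu'\preccurlyeq\mu$ ("$\mu'$ is at least as hard as $\mu$") if $p^*_{\mathrm{MD}}(p;\mu)\le p^*_{\mathrm{MD}}(p;\mu')$ for all $0<p<1$.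 The model is degraded at the null if for any two alternatives $\mu,\mu'$ either $\mu'\preccurlyeq\mu$ or $\mu\preccurlyeq\mu'$ (this holds here). The minimax sets are $\tilde\Theta_\mu=\{\mu_1\ne 0:\mu\preccurlyeq\mu_1\}$, for $\mu\neq 0$; in this normal problem they are exactly the sets $\tilde\Theta(d)=\{\mu_1\ne0:\|\mu_1\|\ge d\}$, $d>0$. $R^*$ is a UMM detector with significance level $p_{\mathrm{FA}}$ if $R^*\in\mathcal{R}(p_{\mathrm{FA}})$ and $R^*$ minimizes $\sup_{\mu_1\in\tilde\Theta_\mu}p_{\mathrm{MD}}(R;\mu_1)$ among all $R\in\mathcal{R}(p_{\mathrm{FA}})$, simultaneously for all minimax sets $\tilde\Theta_\mu$, $\mu\ne 0$. *)

theory Defs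
  imports "HOL-Probability.Probability"
begin

text \<open>The normal distribution on \<^typ>\<open>real ^ 'k\<close>, for a symmetric positive definite covariance
  matrix \<open>\<Sigma>\<close>.\<close>

definition normal_dist :: "real ^ 'k \<Rightarrow> real ^ 'k ^ 'k \<Rightarrow> (real ^ 'k) measure" where
  "normal_dist \<mu> \<Sigma> = density lborel (\<lambda>y. ennreal (
     exp (- ((y - \<mu>) \<bullet> (matrix_inv \<Sigma> *v (y - \<mu>))) / 2)
       / ((2 * pi) powr (real CARD('k) / 2) * sqrt (det \<Sigma>))))"

text \<open>The central chi-squared distribution with \<open>k\<close> degrees of freedom is the law of the sum of
  squares of \<open>k\<close> independent standard normal variables.\<close>

definition chi_square_dist :: "nat \<Rightarrow> real measure" where
  "chi_square_dist k =
     distr (PiM {..<k} (\<lambda>_. density lborel (\<lambda>x. ennreal (std_normal_density x)))) borel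
       (\<lambda>z. \<Sum>i<k. (z i)\<^sup>2)"

definition chi_square_tail :: "nat \<Rightarrow> real \<Rightarrow> real" where
  "chi_square_tail k t = measure (chi_square_dist k) {t<..}"

text \<open>The tail function is constantly 1 on the negative half-line, so it is inverted on the support
  of the distribution.\<close>

definition chi_square_tail_inv :: "nat \<Rightarrow> real \<Rightarrow> real" where
  "chi_square_tail_inv k = inv_into {0..} (chi_square_tail k)"

text \<open>A randomized detector is a Markov kernel: \<open>R y\<close> is the distribution of the output in
  \<open>{0, 1}\<close> given the observation \<open>y\<close>. If \<open>Y\<close> has law \<open>M\<close>, then the output \<open>R(Y)\<close> has law
  \<open>M \<bind> R\<close>. Deterministic detectors are those whose values are point masses \<^const>\<open>return\<close>.\<close>

definition detectors :: "(real ^ 'k \<Rightarrow> nat measure) set" where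
  "detectors = borel \<rightarrow>\<^sub>M prob_algebra (count_space {0, 1})"

definition p_FA :: "(real ^ 'k \<Rightarrow> nat measure) \<Rightarrow> real" where
  "p_FA R = measure (normal_dist 0 (mat 1) \<bind> R) {1}"

definition p_MD :: "(real ^ 'k \<Rightarrow> nat measure) \<Rightarrow> real ^ 'k \<Rightarrow> real" where
  "p_MD R \<mu>\<^sub>1 = measure (normal_dist \<mu>\<^sub>1 (mat 1) \<bind> R) {0}"

definition detectors_level :: "real \<Rightarrow> (real ^ 'k \<Rightarrow> nat measure) set" where
  "detectors_level p = {R \<in> detectors. p_FA R \<le> p}"

text \<open>The minimum is rendered as an infimum, with which it agrees whenever it is attained.\<close>

definition p_MD_opt :: "real \<Rightarrow> real ^ 'k \<Rightarrow> real" where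
  "p_MD_opt p \<mu>\<^sub>1 = (INF R\<in>detectors_level p. p_MD R \<mu>\<^sub>1)"

text \<open>\<open>at_least_as_hard \<mu>' \<mu>\<close> stands for \<open>\<mu>' \<preceq> \<mu>\<close>.\<close>

definition at_least_as_hard :: "real ^ 'k \<Rightarrow> real ^ 'k \<Rightarrow> bool" where
  "at_least_as_hard \<mu>' \<mu> \<longleftrightarrow> (\<forall>p. 0 < p \<and> p < 1 \<longrightarrow> p_MD_opt p \<mu> \<le> p_MD_opt p \<mu>')"

definition minimax_set :: "real ^ 'k \<Rightarrow> (real ^ 'k) set" where
  "minimax_set \<mu> = {\<mu>\<^sub>1. \<mu>\<^sub>1 \<noteq> 0 \<and> at_least_as_hard \<mu> \<mu>\<^sub>1}"

definition UMM_detector :: "real \<Rightarrow> (real ^ 'k \<Rightarrow> nat measure) \<Rightarrow> bool" where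
  "UMM_detector p R \<longleftrightarrow> R \<in> detectors_level p \<and>
     (\<forall>\<mu>. \<mu> \<noteq> 0 \<longrightarrow> (\<forall>R'\<in>detectors_level p.
        (SUP \<mu>\<^sub>1\<in>minimax_set \<mu>. p_MD R \<mu>\<^sub>1) \<le> (SUP \<mu>\<^sub>1\<in>minimax_set \<mu>. p_MD R' \<mu>\<^sub>1)))"

definition norm_detector :: "real \<Rightarrow> real ^ 'k \<Rightarrow> nat measure" where
  "norm_detector p y = return (count_space {0, 1})
     (if (norm y)\<^sup>2 < chi_square_tail_inv CARD('k) p then 0 else 1)"

end

theory Submission
  imports Defs
begin

text \<open>By rotation invariance of the problem, with every alternative a minimax set contains the whole
  sphere through it. Hence it suffices that, on each sphere of alternatives, the (constant) missed
  detection probability of the norm detector is at most the maximal one of any other detector of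
  level \<open>p\<close>. The latter is bounded below by the average for the uniform prior on the sphere, that
  is, by a Bayes risk. The likelihood ratio of this mixture against the null hypothesis is an
  increasing function of \<open>\<parallel>y\<parallel>\<close>, so the norm detector, which has false alarm probability exactly
  \<open>p\<close>, is Bayes by the Neyman-Pearson argument. The order of hardness need not be determined.\<close>

section \<open>Orthogonal invariance of Lebesgue measure\<close>

lemma nn_integral_lborel_translation:
  fixes f :: "'a :: euclidean_space \<Rightarrow> ennreal"
  assumes [measurable]: "f \<in> borel_measurable borel"
  shows "(\<integral>\<^sup>+x. f (c + x) \<partial>lborel) = (\<integral>\<^sup>+x. f x \<partial>lborel)"
  by (subst lborel_distr_plus[of c, symmetric]) (simp add: nn_integral_distr)

lemma borel_measurable_orthogonal_transformation:
  fixes T :: "'a :: euclidean_space \<Rightarrow> 'a"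
  assumes "orthogonal_transformation T"
  shows "T \<in> borel_measurable borel"
  using assms
  by (intro borel_measurable_continuous_onI linear_continuous_on)
     (simp add: orthogonal_transformation_linear flip: linear_conv_bounded_linear)

lemma orthogonal_transformation_inv_apply:
  fixes T :: "'a :: euclidean_space \<Rightarrow> 'a"
  assumes "orthogonal_transformation T"
  shows "T (inv T x) = x" "inv T (T x) = x"
  using orthogonal_transformation_bij[OF assms]
  by (simp_all add: bij_is_surj bij_is_inj surj_f_inv_f)

text \<open>The change of variables theorem of the library is restricted to well-ordered index types.
  Here the invariance follows from translation invariance alone: with \<open>B\<close> the unit ball, both
  \<open>\<lambda>(T\<inverse> A) \<lambda>(B)\<close> and \<open>\<lambda>(A) \<lambda>(B)\<close> are obtained from \<open>\<integral>\<integral> 1\<^sub>A(T x + y) 1\<^sub>B(y) dx dy\<close>.\<close>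

lemma distr_lborel_orthogonal_transformation:
  fixes T :: "'a :: euclidean_space \<Rightarrow> 'a"
  assumes T: "orthogonal_transformation T"
  shows "distr lborel borel T = lborel"
proof (rule measure_eqI)
  fix A assume "A \<in> sets (distr lborel borel T)"
  then have [measurable]: "A \<in> sets borel" by simp
  note [measurable] = borel_measurable_orthogonal_transformation[OF T]
  note inv = orthogonal_transformation_inv_apply[OF T]
  have lin: "linear T"
    using T by (rule orthogonal_transformation_linear)
  define b where "b = emeasure lborel (ball (0::'a) 1)"
  \<comment> \<open>Both facts are needed to cancel the factor \<open>b\<close> at the end.\<close>
  have b: "b \<noteq> 0" "b \<noteq> \<infinity>"
  proof -
    have "measure lborel (ball (0::'a) 1) > 0" by (rule content_ball_pos) simp
    then show "b \<noteq> 0" by (auto simp: b_def measure_def)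
    show "b \<noteq> \<infinity>" using emeasure_lborel_ball_finite[of "0::'a" 1] by (simp add: b_def)
  qed
  have ball: "emeasure lborel (ball x 1) = b" for x :: 'a
    by (simp add: b_def emeasure_ball)
  define B where "B = ball (0::'a) 1"
  have [measurable]: "B \<in> sets borel" by (simp add: B_def)
  have B: "emeasure lborel B = b" by (simp add: B_def b_def)
  let ?I = "\<lambda>x y. indicator A (T x + y) * indicator B y :: ennreal"
  have "emeasure (distr lborel borel T) A * b = (\<integral>\<^sup>+y. \<integral>\<^sup>+x. ?I x y \<partial>lborel \<partial>lborel)"
  proof -
    have "(\<integral>\<^sup>+x. ?I x y \<partial>lborel) = emeasure (distr lborel borel T) A * indicator B y"
      for y
    proof -
      \<comment> \<open>By linearity \<open>T x + y = T (inv T y + x)\<close>, so for fixed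
        \<open>y\<close> the shift is absorbed by a translation of \<open>x\<close>.\<close>
      have "(\<integral>\<^sup>+x. ?I x y \<partial>lborel) =
          (\<integral>\<^sup>+x. indicator A (T (inv T y + x)) \<partial>lborel) * indicator B y"
        by (subst nn_integral_multc) (simp_all add: linear_add[OF lin] inv add.commute)
      also have "(\<integral>\<^sup>+x. indicator A (T (inv T y + x)) \<partial>lborel) =
          (\<integral>\<^sup>+x. indicator A (T x) \<partial>lborel)"
        by (rule nn_integral_lborel_translation) simp
      also have "\<dots> = emeasure (distr lborel borel T) A"
        using nn_integral_distr[of T lborel borel "indicator A"] by simp
      finally show ?thesis .
    qed
    then show ?thesis
      by (simp add: nn_integral_cmult_indicator B)
  qed
  also have "\<dots> = (\<integral>\<^sup>+x. \<integral>\<^sup>+y. ?I x y \<partial>lborel \<partial>lborel)"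
    by (rule lborel_pair.Fubini') measurable
  also have "\<dots> = (\<integral>\<^sup>+x. \<integral>\<^sup>+y. indicator A y * indicator B (y - T x) \<partial>lborel \<partial>lborel)"
  proof (rule nn_integral_cong)
    fix x
    show "(\<integral>\<^sup>+y. ?I x y \<partial>lborel) =
        (\<integral>\<^sup>+y. indicator A y * indicator B (y - T x) \<partial>lborel)"
      using nn_integral_lborel_translation
        [of "\<lambda>y. indicator A y * indicator B (y - T x)" "T x"] by simp
  qed
  also have "\<dots> = (\<integral>\<^sup>+y. \<integral>\<^sup>+x. indicator A y * indicator B (y - T x) \<partial>lborel \<partial>lborel)"
    by (rule lborel_pair.Fubini') measurable
  also have "\<dots> = (\<integral>\<^sup>+y. indicator A y * b \<partial>lborel)"
  proof (rule nn_integral_cong)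
    fix y
    \<comment> \<open>As \<open>T\<close> is an isometry, the points \<open>x\<close> with
      \<open>y - T x\<close> in \<open>B\<close> form a unit ball around \<open>inv T y\<close>,
      whose measure does not depend on \<open>y\<close>.\<close>
    have "norm (y - T x) = dist (inv T y) x" for x
    proof -
      have "y - T x = T (inv T y - x)" by (simp add: linear_diff[OF lin] inv)
      then show ?thesis by (simp add: orthogonal_transformation_norm[OF T] dist_norm)
    qed
    then have "(\<integral>\<^sup>+x. indicator A y * indicator B (y - T x) \<partial>lborel) =
        (\<integral>\<^sup>+x. indicator A y * indicator (ball (inv T y) 1) x \<partial>lborel)"
      by (intro nn_integral_cong) (simp add: indicator_def B_def)
    also have "\<dots> = indicator A y * b"
      by (simp add: nn_integral_cmult_indicator ball)
    finally show "(\<integral>\<^sup>+x. indicator A y * indicator B (y - T x) \<partial>lborel) =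
      indicator A y * b" .
  qed
  also have "\<dots> = emeasure lborel A * b"
    by (simp add: nn_integral_multc)
  finally show "emeasure (distr lborel borel T) A = emeasure lborel A"
    using b by (simp add: ennreal_mult_cancel_left mult.commute[of _ b])
qed simp

section \<open>Normal distributions with identity covariance\<close>

lemma norm_square_eq_sum_Basis:
  fixes y :: "'a :: euclidean_space"
  shows "(norm y)\<^sup>2 = (\<Sum>b\<in>Basis. (y \<bullet> b)\<^sup>2)"
  unfolding power2_norm_eq_inner by (subst euclidean_inner) (simp add: power2_eq_square)

lemma matrix_inv_mat_1: "matrix_inv (mat 1 :: 'a :: semiring_1 ^ 'n ^ 'n) = mat 1"
proof -
  have "\<exists>B :: 'a ^ 'n ^ 'n. mat 1 ** B = mat 1 \<and> B ** mat 1 = mat 1"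
    by (intro exI[of _ "mat 1"]) simp
  then show ?thesis
    unfolding matrix_inv_def by (rule someI2_ex) simp
qed

abbreviation std_normal :: "(real ^ 'k) measure" where
  "std_normal \<equiv> normal_dist 0 (mat 1)"

lemma normal_dist_mat_1:
  "normal_dist \<mu> (mat 1 :: real ^ 'k ^ 'k) =
    density lborel (\<lambda>y. ennreal (exp (- (norm (y - \<mu>))\<^sup>2 / 2) / (2 * pi) powr (CARD('k) / 2)))"
  by (simp add: normal_dist_def matrix_inv_mat_1 power2_norm_eq_inner)

lemma std_normal_eq_density_prod:
  "(std_normal :: (real ^ 'k) measure) =
    density lborel (\<lambda>y. \<Prod>b\<in>Basis. ennreal (std_normal_density (y \<bullet> b)))"
proof -
  have "exp (- (norm y)\<^sup>2 / 2) / (2 * pi) powr (CARD('k) / 2) =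
      (\<Prod>b\<in>Basis. std_normal_density (y \<bullet> b))" for y :: "real ^ 'k"
  proof -
    have "(2 * pi) powr (CARD('k) / 2) = ((2 * pi) powr (1 / 2)) powr CARD('k)"
      by (simp only: powr_powr) simp
    also have "\<dots> = sqrt (2 * pi) ^ CARD('k)"
      by (simp add: powr_half_sqrt powr_realpow)
    finally have "(\<Prod>b\<in>(Basis :: (real ^ 'k) set). 1 / sqrt (2 * pi)) =
        1 / (2 * pi) powr (CARD('k) / 2)"
      by (simp add: power_one_over)
    moreover have "(\<Prod>b\<in>Basis. exp (- (y \<bullet> b)\<^sup>2 / 2)) = exp (- (norm y)\<^sup>2 / 2)"
      unfolding norm_square_eq_sum_Basis
      by (subst exp_sum[symmetric]) (simp_all only: finite_Basis sum_negf[symmetric] sum_divide_distrib)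
    ultimately show ?thesis
      unfolding std_normal_density_def prod.distrib by (simp only: times_divide_eq_left mult_1_left)
  qed
  then show ?thesis
    by (simp add: normal_dist_mat_1 prod_ennreal)
qed

lemma sets_normal_dist [simp, measurable_cong]: "sets (normal_dist \<mu> \<Sigma>) = sets borel"
  and space_normal_dist [simp]: "space (normal_dist \<mu> \<Sigma>) = UNIV"
  by (simp_all add: normal_dist_def)

text \<open>Independence of the coordinates. It yields total mass 1 (all sides \<open>UNIV\<close>)
  and later identifies the vector of coordinates with a product measure.\<close>

lemma emeasure_std_normal_prod:
  fixes A :: "real ^ 'k \<Rightarrow> real set"
  assumes [measurable]: "\<And>b. b \<in> Basis \<Longrightarrow> A b \<in> sets borel"
  shows "emeasure std_normal {y. \<forall>b\<in>Basis. y \<bullet> b \<in> A b} =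
    (\<Prod>b\<in>Basis. emeasure (density lborel std_normal_density) (A b))"
proof -
  let ?S = "{y. \<forall>b\<in>Basis. y \<bullet> b \<in> A b}"
  have [measurable]: "?S \<in> sets borel" by measurable
  have "(\<Prod>b\<in>Basis. indicator (A b) (y \<bullet> b)) = (indicator ?S y :: ennreal)" for y
  proof (cases "y \<in> ?S")
    case False
    then obtain b where "b \<in> Basis" "indicator (A b) (y \<bullet> b) = (0 :: ennreal)" by auto
    with False show ?thesis by (auto intro: prod_zero)
  qed simp
  then have "emeasure std_normal ?S =
      (\<integral>\<^sup>+y. (\<Prod>b\<in>Basis. ennreal (std_normal_density (y \<bullet> b)) * indicator (A b) (y \<bullet> b)) \<partial>lborel)"
    unfolding std_normal_eq_density_prod prod.distrib by (subst emeasure_density) simp_all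
  also have "\<dots> = (\<Prod>b\<in>Basis. \<integral>\<^sup>+x. ennreal (std_normal_density x) * indicator (A b) x \<partial>lborel)"
    by (rule nn_integral_lborel_prod) simp_all
  also have "\<dots> = (\<Prod>b\<in>Basis. emeasure (density lborel std_normal_density) (A b))"
    by (intro prod.cong refl) (simp add: emeasure_density)
  finally show ?thesis .
qed

lemma prob_space_std_normal: "prob_space (std_normal :: (real ^ 'k) measure)"
proof
  interpret prob_space "density lborel std_normal_density"
    by (rule prob_space_normal_density) simp
  show "emeasure std_normal (space (std_normal :: (real ^ 'k) measure)) = 1"
    using emeasure_std_normal_prod[of "\<lambda>_. UNIV"] emeasure_space_1 by simp
qed

text \<open>Expanding the square gives the likelihood ratio against the null; all alternatives
  become densities over one common probability measure.\<close>

lemma normal_dist_eq_density_std_normal: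
  "normal_dist \<mu> (mat 1) = density std_normal (\<lambda>y. ennreal (exp (\<mu> \<bullet> y - (norm \<mu>)\<^sup>2 / 2)))"
proof -
  have "- (norm (y - \<mu>))\<^sup>2 / 2 = - (norm y)\<^sup>2 / 2 + (\<mu> \<bullet> y - (norm \<mu>)\<^sup>2 / 2)" for y
    by (simp add: power2_norm_eq_inner inner_diff_left inner_diff_right inner_commute[of y \<mu>] field_simps)
  then have "exp (- (norm (y - \<mu>))\<^sup>2 / 2) =
      exp (- (norm y)\<^sup>2 / 2) * exp (\<mu> \<bullet> y - (norm \<mu>)\<^sup>2 / 2)" for y
    by (simp only: exp_add)
  then show ?thesis
    unfolding normal_dist_mat_1
    by (subst density_density_eq) (simp_all add: ennreal_mult'[symmetric] del: exp_add)
qed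

text \<open>Carries total mass 1 over from the null hypothesis to every mean.\<close>

lemma distr_normal_dist_translation:
  fixes \<mu> :: "real ^ 'k"
  shows "distr std_normal borel ((+) \<mu>) = normal_dist \<mu> (mat 1)"
proof -
  let ?f = "\<lambda>\<nu> y :: real ^ 'k.
      ennreal (exp (- (norm (y - \<nu>))\<^sup>2 / 2) / (2 * pi) powr (CARD('k) / 2))"
  have "density (distr lborel borel ((+) \<mu>)) (?f \<mu>) =
      distr (density lborel (\<lambda>y. ?f \<mu> (\<mu> + y))) borel ((+) \<mu>)"
    by (rule density_distr) measurable
  then show ?thesis
    unfolding normal_dist_mat_1 lborel_distr_plus by (simp only: add_diff_cancel_left' diff_zero)
qed

lemma prob_space_normal_dist_mat_1: "prob_space (normal_dist \<mu> (mat 1))"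
  by (subst distr_normal_dist_translation[symmetric])
    (rule prob_space.prob_space_distr[OF prob_space_std_normal], simp)

text \<open>Both Lebesgue measure and the distance to the mean are preserved by
  \<open>T\<close>.\<close>

lemma distr_normal_dist_orthogonal_transformation:
  fixes T :: "real ^ 'k \<Rightarrow> real ^ 'k"
  assumes T: "orthogonal_transformation T"
  shows "distr (normal_dist \<mu> (mat 1)) borel T = normal_dist (T \<mu>) (mat 1)"
proof -
  note [measurable] = borel_measurable_orthogonal_transformation[OF T]
  have "norm (T y - T \<mu>) = norm (y - \<mu>)" for y
    using T by (metis linear_diff orthogonal_transformation_linear orthogonal_transformation_norm)
  moreover let ?f = "\<lambda>\<nu> y :: real ^ 'k.
      ennreal (exp (- (norm (y - \<nu>))\<^sup>2 / 2) / (2 * pi) powr (CARD('k) / 2))"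
  have "density (distr lborel borel T) (?f (T \<mu>)) =
      distr (density lborel (\<lambda>y. ?f (T \<mu>) (T y))) borel T"
    by (rule density_distr) measurable
  ultimately show ?thesis
    unfolding normal_dist_mat_1 distr_lborel_orthogonal_transformation[OF T] by (simp only:)
qed

lemma null_sets_normal_dist_mat_1:
  assumes "negligible A" and "A \<in> sets borel"
  shows "A \<in> null_sets (normal_dist \<mu> (mat 1))"
proof -
  have "A \<in> null_sets lborel"
    using assms by (auto simp: negligible_iff_null_sets null_sets_completion_iff)
  then have "AE x in lborel. x \<notin> A" by (rule AE_not_in)
  then show ?thesis
    unfolding normal_dist_mat_1 using assms by (subst null_sets_density_iff) auto
qed

section \<open>The chi-squared distribution\<close>

text \<open>The definition lives on functions over \<open>{..<k}\<close>, the detector on vectors.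
  An enumeration \<open>h\<close> of the basis links them, and agreement on boxes identifies the two
  laws.\<close>

lemma chi_square_dist_eq_distr_std_normal:
  "chi_square_dist CARD('k) = distr (std_normal :: (real ^ 'k) measure) borel (\<lambda>y. (norm y)\<^sup>2)"
proof -
  let ?N = "density lborel (\<lambda>x. ennreal (std_normal_density x))"
  let ?I = "{..<CARD('k)}"
  have "card (Basis :: (real ^ 'k) set) = CARD('k)" by simp
  then obtain h where h: "bij_betw h ?I (Basis :: (real ^ 'k) set)"
    by (metis ex_bij_betw_nat_finite finite_Basis lessThan_atLeast0)
  have hB: "h i \<in> Basis" if "i \<in> ?I" for i
    using h that by (auto dest: bij_betw_apply)
  interpret N: prob_space ?N
    by (rule prob_space_normal_density) simp
  interpret product_sigma_finite "\<lambda>_. ?N"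
    by unfold_locales
  define P where "P = distr std_normal (PiM ?I (\<lambda>_. ?N)) (\<lambda>y. \<lambda>i\<in>?I. y \<bullet> h i)"
  have meas [measurable]:
    "(\<lambda>y. \<lambda>i\<in>?I. y \<bullet> h i) \<in> (std_normal :: (real ^ 'k) measure) \<rightarrow>\<^sub>M PiM ?I (\<lambda>_. ?N)"
    by (rule measurable_restrict) measurable
  have "P = PiM ?I (\<lambda>_. ?N)"
  proof (rule PiM_eqI)
    fix A assume "\<And>i. i \<in> ?I \<Longrightarrow> A i \<in> sets ?N"
    then have A [measurable]: "A i \<in> sets borel" if "i \<in> ?I" for i
      using that by simp
    \<comment> \<open>The sides of the box, indexed by basis vectors instead of numbers.\<close>
    define A' where "A' = (\<lambda>b. A (inv_into ?I h b))"
    have A'_h: "A' (h i) = A i" if "i \<in> ?I" for i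
      using h that by (simp add: A'_def bij_betw_inv_into_left)
    have A'_meas: "A' b \<in> sets borel" if "b \<in> Basis" for b
      using that bij_betw_apply[OF bij_betw_inv_into[OF h]] by (auto simp: A'_def intro!: A)
    have "emeasure P (Pi\<^sub>E ?I A) =
        emeasure (std_normal :: (real ^ 'k) measure)
          ((\<lambda>y. \<lambda>i\<in>?I. y \<bullet> h i) -` Pi\<^sub>E ?I A \<inter> space (std_normal :: (real ^ 'k) measure))"
      unfolding P_def using A by (intro emeasure_distr meas sets_PiM_I_finite) auto
    also have "(\<lambda>y. \<lambda>i\<in>?I. y \<bullet> h i) -` Pi\<^sub>E ?I A \<inter> space (std_normal :: (real ^ 'k) measure) =
        {y. \<forall>i\<in>?I. y \<bullet> h i \<in> A' (h i)}"
      using A'_h by (auto simp: PiE_iff)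
    also have "\<dots> = {y. \<forall>b\<in>Basis. y \<bullet> b \<in> A' b}"
      by (subst bij_betw_imp_surj_on[OF h, symmetric]) auto
    also have "emeasure std_normal \<dots> = (\<Prod>b\<in>Basis. emeasure ?N (A' b))"
      by (rule emeasure_std_normal_prod[OF A'_meas])
    also have "\<dots> = (\<Prod>i\<in>?I. emeasure ?N (A' (h i)))"
      by (rule prod.reindex_bij_betw[OF h, symmetric])
    also have "\<dots> = (\<Prod>i\<in>?I. emeasure ?N (A i))"
      using A'_h by (intro prod.cong) simp_all
    finally show "emeasure P (Pi\<^sub>E ?I A) = (\<Prod>i\<in>?I. emeasure ?N (A i))" .
  qed (simp_all add: P_def)
  then have "chi_square_dist CARD('k) = distr P borel (\<lambda>z. \<Sum>i\<in>?I. (z i)\<^sup>2)"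
    by (simp add: chi_square_dist_def)
  also have "\<dots> = distr (std_normal :: (real ^ 'k) measure) borel
      ((\<lambda>z. \<Sum>i\<in>?I. (z i)\<^sup>2) \<circ> (\<lambda>y. \<lambda>i\<in>?I. y \<bullet> h i))"
    unfolding P_def by (rule distr_distr) simp_all
  also have "(\<lambda>z. \<Sum>i\<in>?I. (z i)\<^sup>2) \<circ> (\<lambda>y. \<lambda>i\<in>?I. y \<bullet> h i) = (\<lambda>y. (norm y)\<^sup>2)"
  proof
    fix y :: "real ^ 'k"
    have "(\<Sum>i\<in>?I. (y \<bullet> h i)\<^sup>2) = (\<Sum>b\<in>Basis. (y \<bullet> b)\<^sup>2)"
      by (rule sum.reindex_bij_betw[OF h])
    then show "((\<lambda>z. \<Sum>i\<in>?I. (z i)\<^sup>2) \<circ> (\<lambda>y. \<lambda>i\<in>?I. y \<bullet> h i)) y = (norm y)\<^sup>2"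
      by (simp add: norm_square_eq_sum_Basis)
  qed
  finally show ?thesis .
qed

lemma negligible_norm_square_eq: "negligible {y :: 'a :: euclidean_space. (norm y)\<^sup>2 = t}"
proof (rule negligible_subset[OF negligible_sphere])
  show "{y. (norm y)\<^sup>2 = t} \<subseteq> sphere (0 :: 'a) (sqrt t)" by auto
qed

text \<open>The squared norm has no atoms, so its distribution function is continuous and attains
  \<open>1 - p\<close> by the intermediate value theorem. Hence the test has size exactly
  \<open>p\<close>.\<close>

lemma measure_std_normal_norm_less:
  fixes p :: real
  assumes "0 < p" "p < 1"
  shows "measure (std_normal :: (real ^ 'k) measure)
    {y. (norm y)\<^sup>2 < chi_square_tail_inv CARD('k) p} = 1 - p"
proof -
  let ?X = "chi_square_dist CARD('k)" and ?G = "std_normal :: (real ^ 'k) measure"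
  note X = chi_square_dist_eq_distr_std_normal[where 'k = 'k]
  interpret G: prob_space ?G by (rule prob_space_std_normal)
  interpret X: prob_space ?X
    unfolding X by (rule G.prob_space_distr) simp
  interpret X: real_distribution ?X
    by unfold_locales (simp_all add: X)
  have measure_X: "measure ?X A = measure ?G {y. (norm y)\<^sup>2 \<in> A}" if "A \<in> sets borel" for A
    unfolding X using that by (subst measure_distr) (auto simp: vimage_def)
  have atom: "measure ?X {t} = 0" for t
  proof -
    have "{y :: real ^ 'k. (norm y)\<^sup>2 = t} \<in> null_sets ?G"
      by (rule null_sets_normal_dist_mat_1[OF negligible_norm_square_eq]) measurable
    then show ?thesis
      using measure_X[of "{t}"] by (simp add: measure_eq_0_null_sets)
  qed
  have tail: "chi_square_tail CARD('k) t = 1 - cdf ?X t" for t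
  proof -
    have "{t<..} = space ?X - {..t}" by (auto simp: X)
    then show ?thesis
      unfolding chi_square_tail_def cdf_def by (metis X.prob_compl X.sets_M borel_closed closed_atMost)
  qed
  \<comment> \<open>A squared norm is at most 0 only at the origin.\<close>
  have "cdf ?X 0 = measure ?X {0}"
    unfolding cdf_def by (simp add: measure_X)
  then have cdf_0: "cdf ?X 0 = 0" by (simp add: atom)
  have "\<forall>\<^sub>F x in at_top. 1 - p < cdf ?X x"
    using order_tendstoD(1)[OF X.cdf_lim_at_top_prob] assms by simp
  then obtain b where b: "0 \<le> b" "1 - p < cdf ?X b"
    by (metis (mono_tags, lifting) eventually_at_top_linorder linorder_le_cases)
  then obtain t where "0 \<le> t" "cdf ?X t = 1 - p"
    using IVT[of "cdf ?X" 0 "1 - p" b] assms cdf_0 by (auto simp: X.isCont_cdf atom)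
  \<comment> \<open>Membership in the image makes \<open>inv_into\<close> a genuine right inverse at
    \<open>p\<close> rather than an arbitrary value.\<close>
  then have "p \<in> chi_square_tail CARD('k) ` {0..}"
    by (intro image_eqI[of _ _ t]) (simp_all add: tail)
  then have "chi_square_tail CARD('k) (chi_square_tail_inv CARD('k) p) = p"
    unfolding chi_square_tail_inv_def by (rule f_inv_into_f)
  then have "cdf ?X (chi_square_tail_inv CARD('k) p) = 1 - p"
    by (simp add: tail)
  \<comment> \<open>The detector accepts on a strict inequality, whereas \<open>cdf\<close> uses the
    closed half-line; the difference is an atom of mass 0.\<close>
  moreover have "cdf ?X s = measure ?X {..<s}" for s
    using atom[of s] X.finite_measure_Union[of "{..<s}" "{s}"]
    by (simp add: cdf_def flip: ivl_disj_un_singleton(2))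
  ultimately show ?thesis by (simp add: measure_X)
qed

section \<open>Detectors\<close>

lemma
  fixes R :: "real ^ 'k \<Rightarrow> nat measure"
  assumes "R \<in> detectors"
  shows measurable_detector: "R \<in> borel \<rightarrow>\<^sub>M subprob_algebra (count_space {0, 1})"
    and prob_space_detector: "prob_space (R y)"
    and sets_detector: "sets (R y) = sets (count_space {0, 1})"
proof -
  have R: "R \<in> borel \<rightarrow>\<^sub>M prob_algebra (count_space {0, 1})"
    using assms by (simp only: detectors_def)
  then show "R \<in> borel \<rightarrow>\<^sub>M subprob_algebra (count_space {0, 1})"
    by (rule measurable_prob_algebraD)
  have "R y \<in> space (prob_algebra (count_space {0, 1}))"
    using R by (rule measurable_space) simp
  then show "prob_space (R y)" "sets (R y) = sets (count_space {0, 1})"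
    by (simp_all add: space_prob_algebra)
qed

lemma measurable_detector_normal_dist:
  assumes "R \<in> detectors"
  shows "R \<in> normal_dist \<mu> \<Sigma> \<rightarrow>\<^sub>M subprob_algebra (count_space {0, 1})"
  using measurable_detector[OF assms] by (simp cong: measurable_cong_sets)

lemma borel_measurable_accept [measurable]:
  "R \<in> detectors \<Longrightarrow> (\<lambda>y. measure (R y) {0}) \<in> borel_measurable borel"
  by (rule measurable_compose[OF measurable_detector measurable_measure_subprob_algebra]) auto

text \<open>From here on a randomized detector acts as a test function with values in [0, 1], its
  acceptance probability.\<close>

lemma p_MD_eq_integral:
  assumes "R \<in> detectors"
  shows "p_MD R \<mu> = (\<integral>y. measure (R y) {0} \<partial>normal_dist \<mu> (mat 1))"
proof -
  interpret prob_space "normal_dist \<mu> (mat 1)" by (rule prob_space_normal_dist_mat_1)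
  show ?thesis
    unfolding p_MD_def by (rule measure_bind[OF measurable_detector_normal_dist[OF assms]]) simp
qed

text \<open>Here \<open>p_MD R 0\<close> is the probability of accepting under the null. The level
  constraint thus becomes a bound on the same integral as for the alternatives, at mean 0.\<close>

lemma p_FA_eq_p_MD_0:
  assumes "R \<in> detectors"
  shows "p_FA R = 1 - p_MD R 0"
proof -
  interpret prob_space "std_normal :: (real ^ 'a) measure" by (rule prob_space_std_normal)
  have "p_FA R = (\<integral>y. measure (R y) {1} \<partial>std_normal)"
    unfolding p_FA_def by (rule measure_bind[OF measurable_detector_normal_dist[OF assms]]) simp
  also have "\<dots> = (\<integral>y. 1 - measure (R y) {0} \<partial>std_normal)"
  proof (intro Bochner_Integration.integral_cong refl)
    fix y
    interpret Ry: prob_space "R y" by (rule prob_space_detector[OF assms])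
    have "space (R y) = {0, 1}"
      using sets_eq_imp_space_eq[OF sets_detector[OF assms, of y]] by simp
    then have "{1} = space (R y) - {0}" by auto
    then show "measure (R y) {1} = 1 - measure (R y) {0}"
      using Ry.prob_compl[of "{0}"] sets_detector[OF assms, of y] by simp
  qed
  also have "\<dots> = 1 - p_MD R 0"
  proof -
    have "integrable std_normal (\<lambda>y. measure (R y) {0})"
      using assms prob_space.prob_le_1[OF prob_space_detector[OF assms]]
      by (intro integrable_const_bound[of _ 1]) auto
    then show ?thesis
      using prob_space by (simp add: p_MD_eq_integral[OF assms])
  qed
  finally show ?thesis .
qed

lemma p_MD_le_1:
  assumes R: "R \<in> detectors"
  shows "p_MD R \<mu> \<le> 1"
proof -
  interpret prob_space "normal_dist \<mu> (mat 1)" by (rule prob_space_normal_dist_mat_1)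
  show "p_MD R \<mu> \<le> 1"
    unfolding p_MD_def
    by (rule subprob_space.subprob_measure_le_1
          [OF subprob_space_bind[OF _ measurable_detector_normal_dist[OF R]]]) unfold_locales
qed

section \<open>Rotations acting on detectors and on hardness\<close>

lemma
  fixes T :: "real ^ 'k \<Rightarrow> real ^ 'k"
  assumes T: "orthogonal_transformation T" and R: "R \<in> detectors"
  shows detector_orthogonal_transformation: "R \<circ> T \<in> detectors"
    and p_MD_orthogonal_transformation: "p_MD (R \<circ> T) \<mu> = p_MD R (T \<mu>)"
proof -
  note [measurable] = borel_measurable_orthogonal_transformation[OF T] measurable_detector[OF R]
  show "R \<circ> T \<in> detectors"
    using R unfolding detectors_def by (auto intro: measurable_comp[of T borel borel])
  \<comment> \<open>Feeding the detector a rotated observation amounts to rotating the mean.\<close>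
  have "normal_dist (T \<mu>) (mat 1) \<bind> R = normal_dist \<mu> (mat 1) \<bind> (\<lambda>y. R (T y))"
    unfolding distr_normal_dist_orthogonal_transformation[OF T, symmetric]
    by (rule bind_distr[OF _ measurable_detector[OF R]]) simp_all
  then show "p_MD (R \<circ> T) \<mu> = p_MD R (T \<mu>)"
    by (simp add: p_MD_def comp_def)
qed

lemma p_MD_opt_orthogonal_transformation:
  fixes T :: "real ^ 'k \<Rightarrow> real ^ 'k"
  assumes T: "orthogonal_transformation T"
  shows "p_MD_opt p (T \<mu>) = p_MD_opt p \<mu>"
proof -
  have level: "R \<circ> S \<in> detectors_level p"
    if "orthogonal_transformation S" "R \<in> detectors_level p" for R and S :: "real ^ 'k \<Rightarrow> real ^ 'k"
  proof -
    \<comment> \<open>The null mean is fixed, so rotating a detector keeps its false alarm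
      probability.\<close>
    have "S 0 = 0" using that(1) by (simp add: orthogonal_transformation_linear linear_0)
    then show ?thesis
      using that by (auto simp: detectors_level_def detector_orthogonal_transformation
          p_FA_eq_p_MD_0 p_MD_orthogonal_transformation)
  qed
  have sub: "(\<lambda>R. p_MD R (S \<mu>)) ` detectors_level p \<subseteq> (\<lambda>R. p_MD R \<mu>) ` detectors_level p"
    if S: "orthogonal_transformation S" for \<mu> :: "real ^ 'k" and S :: "real ^ 'k \<Rightarrow> real ^ 'k"
  proof (rule image_subsetI)
    fix R :: "real ^ 'k \<Rightarrow> nat measure"
    assume R: "R \<in> detectors_level p"
    then have "p_MD R (S \<mu>) = p_MD (R \<circ> S) \<mu>"
      by (simp add: detectors_level_def p_MD_orthogonal_transformation[OF S])
    with level[OF S R] show "p_MD R (S \<mu>) \<in> (\<lambda>R. p_MD R \<mu>) ` detectors_level p"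
      by auto
  qed
  \<comment> \<open>The inverse rotation gives the converse inclusion, so both infima range over the
    same set of values.\<close>
  have "(\<lambda>R. p_MD R \<mu>) ` detectors_level p \<subseteq> (\<lambda>R. p_MD R (T \<mu>)) ` detectors_level p"
    using sub[OF orthogonal_transformation_inv[OF T], of "T \<mu>"]
    by (simp add: orthogonal_transformation_inv_apply[OF T])
  with sub[OF T, of \<mu>] show ?thesis
    unfolding p_MD_opt_def by (metis subset_antisym)
qed

text \<open>Rotations act transitively on spheres and preserve hardness, so minimax sets are unions
  of spheres.\<close>

lemma minimax_set_norm_invariant:
  fixes \<nu> :: "real ^ 'k"
  assumes "\<nu> \<in> minimax_set \<mu>" "norm \<nu>' = norm \<nu>"
  shows "\<nu>' \<in> minimax_set \<mu>"
proof -
  obtain T where "orthogonal_transformation T" "T \<nu> = \<nu>'"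
    using orthogonal_transformation_exists[OF assms(2)[symmetric]] .
  then have "p_MD_opt p \<nu>' = p_MD_opt p \<nu>" for p
    using p_MD_opt_orthogonal_transformation by blast
  with assms show ?thesis
    by (auto simp: minimax_set_def at_least_as_hard_def)
qed

section \<open>The norm detector: acceptance region, size and invariance\<close>

lemma
  shows norm_detector_in_detectors: "norm_detector p \<in> detectors"
    and accept_norm_detector: "measure (norm_detector p y) {0} =
      indicator {y. (norm y)\<^sup>2 < chi_square_tail_inv CARD('k) p} (y :: real ^ 'k)"
proof -
  show "norm_detector p \<in> detectors"
    unfolding detectors_def norm_detector_def
    by (rule measurable_compose[OF _ measurable_return_prob_space]) simp
  show "measure (norm_detector p y) {0} =
      indicator {y. (norm y)\<^sup>2 < chi_square_tail_inv CARD('k) p} (y :: real ^ 'k)"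
    by (simp add: norm_detector_def measure_return indicator_def)
qed

lemma p_MD_norm_detector_0:
  assumes "0 < p" "p < 1"
  shows "p_MD (norm_detector p) (0 :: real ^ 'k) = 1 - p"
  by (simp add: p_MD_eq_integral norm_detector_in_detectors accept_norm_detector
      measure_std_normal_norm_less[OF assms])

lemma p_MD_norm_detector_cong:
  fixes \<nu> \<nu>' :: "real ^ 'k"
  assumes "norm \<nu>' = norm \<nu>"
  shows "p_MD (norm_detector p) \<nu>' = p_MD (norm_detector p) \<nu>"
proof -
  obtain T where T: "orthogonal_transformation T" "T \<nu> = \<nu>'"
    using orthogonal_transformation_exists[OF assms[symmetric]] .
  have "norm_detector p \<circ> T = norm_detector p"
    by (simp add: fun_eq_iff norm_detector_def orthogonal_transformation_norm[OF T(1)])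
  then show ?thesis
    using p_MD_orthogonal_transformation[OF T(1) norm_detector_in_detectors, of p \<nu>] T(2) by simp
qed

section \<open>The spherical mixture\<close>

lemma
  fixes \<nu> :: "real ^ 'k"
  shows integrable_likelihood_ratio:
      "integrable std_normal (\<lambda>y. exp (\<nu> \<bullet> y - (norm \<nu>)\<^sup>2 / 2))"
    and integral_likelihood_ratio:
      "(\<integral>y. exp (\<nu> \<bullet> y - (norm \<nu>)\<^sup>2 / 2) \<partial>std_normal) = 1"
proof -
  interpret prob_space "normal_dist \<nu> (mat 1)" by (rule prob_space_normal_dist_mat_1)
  let ?f = "\<lambda>y. exp (\<nu> \<bullet> y - (norm \<nu>)\<^sup>2 / 2)"
  have "integrable (normal_dist \<nu> (mat 1)) (\<lambda>_. 1 :: real)" by simp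
  then show "integrable std_normal ?f"
    unfolding normal_dist_eq_density_std_normal[of \<nu>] by (subst (asm) integrable_density) simp_all
  have "(\<integral>y. 1 \<partial>normal_dist \<nu> (mat 1)) = (1 :: real)" using prob_space by simp
  then show "(\<integral>y. ?f y \<partial>std_normal) = 1"
    unfolding normal_dist_eq_density_std_normal[of \<nu>] by (subst (asm) integral_density) simp_all
qed

lemma p_MD_eq_integral_std_normal:
  assumes "R \<in> detectors"
  shows "p_MD R \<nu> =
    (\<integral>y. measure (R y) {0} * exp (\<nu> \<bullet> y - (norm \<nu>)\<^sup>2 / 2) \<partial>std_normal)"
  unfolding p_MD_eq_integral[OF assms] normal_dist_eq_density_std_normal[of \<nu>]
  using assms by (subst integral_density) (simp_all add: mult.commute)

lemma sgn_orthogonal_transformation: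
  "orthogonal_transformation T \<Longrightarrow> sgn (T z) = T (sgn z)"
  by (simp add: sgn_div_norm orthogonal_transformation_norm orthogonal_transformation_scaleR)

lemma borel_measurable_sgn_vector [measurable]:
  "(sgn :: 'a :: euclidean_space \<Rightarrow> 'a) \<in> borel_measurable borel"
  unfolding sgn_div_norm[abs_def] by measurable

text \<open>The likelihood ratio of the mixture of the alternatives on the sphere of radius \<open>d\<close>; if
  \<open>z\<close> is standard normal, \<open>d sgn z\<close> is uniformly distributed on that sphere.\<close>

definition sphere_likelihood_ratio :: "real \<Rightarrow> real ^ 'k \<Rightarrow> real" where
  "sphere_likelihood_ratio d y =
    (\<integral>z. exp ((d *\<^sub>R sgn z) \<bullet> y - (norm (d *\<^sub>R sgn z))\<^sup>2 / 2) \<partial>std_normal)"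

lemma sphere_likelihood_ratio_nonneg: "0 \<le> sphere_likelihood_ratio d y"
  by (simp add: sphere_likelihood_ratio_def)

text \<open>The vector \<open>d *\<^sub>R sgn z\<close> has norm at most
  \<open>\<bar>d\<bar>\<close>, so for fixed \<open>y\<close> the integrand is bounded.\<close>

lemma integrable_sphere_likelihood_ratio:
  fixes y :: "real ^ 'k"
  shows "integrable std_normal (\<lambda>z. exp ((d *\<^sub>R sgn z) \<bullet> y - (norm (d *\<^sub>R sgn z))\<^sup>2 / 2))"
proof -
  interpret prob_space "std_normal :: (real ^ 'k) measure" by (rule prob_space_std_normal)
  have "(d *\<^sub>R sgn z) \<bullet> y - (norm (d *\<^sub>R sgn z))\<^sup>2 / 2 \<le> \<bar>d\<bar> * norm y" for z :: "real ^ 'k"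
  proof -
    have "(d *\<^sub>R sgn z) \<bullet> y \<le> norm (d *\<^sub>R sgn z) * norm y" by (rule norm_cauchy_schwarz)
    also have "\<dots> \<le> \<bar>d\<bar> * norm y"
      by (intro mult_right_mono) (simp_all add: norm_sgn)
    finally show ?thesis using zero_le_power2[of "norm (d *\<^sub>R sgn z)"] by linarith
  qed
  then show ?thesis
    by (intro integrable_const_bound[of _ "exp (\<bar>d\<bar> * norm y)"]) auto
qed

text \<open>Substituting \<open>T z\<close> for \<open>z\<close> preserves the standard normal law,
  and rotating both vectors preserves their inner product.\<close>

lemma sphere_likelihood_ratio_orthogonal_transformation:
  fixes T :: "real ^ 'k \<Rightarrow> real ^ 'k"
  assumes T: "orthogonal_transformation T"
  shows "sphere_likelihood_ratio d (T y) = sphere_likelihood_ratio d y"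
proof -
  note [measurable] = borel_measurable_orthogonal_transformation[OF T]
  let ?f = "\<lambda>z y :: real ^ 'k. exp ((d *\<^sub>R sgn z) \<bullet> y - (norm (d *\<^sub>R sgn z))\<^sup>2 / 2)"
  have "T 0 = 0" using T by (simp add: orthogonal_transformation_linear linear_0)
  then have "sphere_likelihood_ratio d (T y) = (\<integral>z. ?f z (T y) \<partial>distr std_normal borel T)"
    using distr_normal_dist_orthogonal_transformation[OF T, of 0]
    by (simp add: sphere_likelihood_ratio_def)
  also have "\<dots> = (\<integral>z. ?f (T z) (T y) \<partial>std_normal)"
    by (rule integral_distr) measurable
  also have "\<dots> = sphere_likelihood_ratio d y"
    using T by (simp add: sphere_likelihood_ratio_def sgn_orthogonal_transformation norm_sgn
        orthogonal_transformation_norm orthogonal_transformation_def)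
  finally show ?thesis .
qed

lemma sphere_likelihood_ratio_norm_cong:
  fixes y y' :: "real ^ 'k"
  assumes "norm y = norm y'"
  shows "sphere_likelihood_ratio d y = sphere_likelihood_ratio d y'"
  using orthogonal_transformation_exists[OF assms] sphere_likelihood_ratio_orthogonal_transformation
  by metis

text \<open>Averaging over \<open>\<plusminus>y\<close> turns the integrand into a hyperbolic cosine, which is increasing in the
  absolute value of its argument.\<close>

lemma sphere_likelihood_ratio_mono:
  fixes y y' :: "real ^ 'k"
  assumes "norm y \<le> norm y'"
  shows "sphere_likelihood_ratio d y \<le> sphere_likelihood_ratio d y'"
proof -
  \<comment> \<open>Only the norm of the argument matters, so all arguments are moved to the axis
    through \<open>e\<close>; the integrands can then be compared pointwise in
    \<open>z\<close>.\<close>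
  obtain e :: "real ^ 'k" where e: "norm e = 1"
    using vector_choose_size[of 1] by auto
  define w where "w = (\<lambda>z :: real ^ 'k. exp (- (norm (d *\<^sub>R sgn z))\<^sup>2 / 2))"
  define a where "a = (\<lambda>z. (d *\<^sub>R sgn z) \<bullet> e)"
  have int: "integrable std_normal (\<lambda>z. w z * exp (r * a z))" for r
    using integrable_sphere_likelihood_ratio[of d "r *\<^sub>R e"]
    by (simp add: w_def a_def flip: exp_add)
  have eq: "sphere_likelihood_ratio d (r *\<^sub>R e) = (\<integral>z. w z * exp (r * a z) \<partial>std_normal)" for r
    by (simp add: sphere_likelihood_ratio_def w_def a_def flip: exp_add)
  have cosh: "sphere_likelihood_ratio d x = (\<integral>z. w z * cosh (norm x * a z) \<partial>std_normal)"
    for x :: "real ^ 'k"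
  proof -
    have "(\<integral>z. w z * cosh (norm x * a z) \<partial>std_normal) =
        (\<integral>z. (w z * exp (norm x * a z) + w z * exp (- norm x * a z)) / 2 \<partial>std_normal)"
      by (simp add: cosh_def field_simps)
    also have "\<dots> =
        (sphere_likelihood_ratio d (norm x *\<^sub>R e) + sphere_likelihood_ratio d ((- norm x) *\<^sub>R e)) / 2"
      unfolding eq using int[of "norm x"] int[of "- norm x"] by simp
    \<comment> \<open>The two points on the axis have the same norm as \<open>x\<close>, so both
      terms equal the value at \<open>x\<close>.\<close>
    also have "\<dots> = sphere_likelihood_ratio d x"
      using sphere_likelihood_ratio_norm_cong[of "norm x *\<^sub>R e" x d]
        sphere_likelihood_ratio_norm_cong[of "(- norm x) *\<^sub>R e" x d] e by simp
    finally show ?thesis by simp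
  qed
  have int_cosh: "integrable std_normal (\<lambda>z. w z * cosh (r * a z))" for r
    using int[of r] int[of "- r"]
    by (simp add: cosh_def distrib_left)
  have "w z * cosh (norm y * a z) \<le> w z * cosh (norm y' * a z)" for z
  proof -
    have "cosh \<bar>norm y * a z\<bar> \<le> cosh \<bar>norm y' * a z\<bar>"
      using assms by (subst cosh_real_nonneg_le_iff) (auto simp: abs_mult mult_right_mono)
    then show ?thesis by (simp add: w_def)
  qed
  then show ?thesis
    unfolding cosh by (intro integral_mono int_cosh)
qed

lemma detector_accept_le_1: "R \<in> detectors \<Longrightarrow> measure (R y) {0} \<le> 1"
  by (rule prob_space.prob_le_1[OF prob_space_detector])

section \<open>Minimaxity on spheres\<close>

text \<open>The pointwise Neyman-Pearson inequality: \<open>D\<close> is nonpositive where the norm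
  detector accepts and nonnegative elsewhere, while the mixture likelihood ratio lies below,
  respectively above, its value at the threshold point \<open>x\<close>. The \<open>max\<close>
  provides a valid radius even for a negative threshold.\<close>

lemma norm_detector_accept_comparison:
  fixes x y :: "real ^ 'k" and p :: real
  assumes "R \<in> detectors"
  defines "t \<equiv> chi_square_tail_inv CARD('k) p"
  defines "D \<equiv> measure (R y) {0} - measure (norm_detector p y) {0}"
  assumes e: "norm x = sqrt (max 0 t)"
  shows "D * sphere_likelihood_ratio d x \<le> D * sphere_likelihood_ratio d y"
proof (cases "(norm y)\<^sup>2 < t")
  case True
  then have "measure (norm_detector p y) {0} = 1"
    by (simp add: accept_norm_detector t_def)
  then have "D \<le> 0"
    using detector_accept_le_1[OF assms(1)] by (simp add: D_def)
  moreover have "norm y \<le> norm x"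
    using True unfolding e by (intro real_le_rsqrt) auto
  ultimately show ?thesis
    by (intro mult_left_mono_neg sphere_likelihood_ratio_mono)
next
  case False
  then have "measure (norm_detector p y) {0} = 0"
    by (simp add: accept_norm_detector t_def)
  then have "0 \<le> D"
    by (simp add: D_def)
  moreover have "norm x \<le> norm y"
    using False unfolding e by (intro real_le_lsqrt) auto
  ultimately show ?thesis
    by (intro mult_left_mono sphere_likelihood_ratio_mono)
qed

text \<open>The Bayes argument for the uniform prior on the sphere through \<open>\<mu>\<close>. The
  difference of the averaged missed detection probabilities is the integral of \<open>D\<close>
  times the mixture likelihood ratio, which is nonnegative. The average for \<open>R\<close> is at
  most \<open>s\<close>, and the norm detector is constant on the sphere.\<close>

lemma p_MD_norm_detector_le:
  fixes \<mu> :: "real ^ 'k" and R :: "real ^ 'k \<Rightarrow> nat measure"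
  assumes p: "0 < p" "p < 1" and R: "R \<in> detectors_level p"
    and le: "\<And>\<nu>. norm \<nu> = norm \<mu> \<Longrightarrow> p_MD R \<nu> \<le> s"
  shows "p_MD (norm_detector p) \<mu> \<le> s"
proof -
  let ?G = "std_normal :: (real ^ 'k) measure"
  interpret G: prob_space ?G by (rule prob_space_std_normal)
  interpret GG: pair_sigma_finite ?G ?G ..
  have R_det [measurable]: "R \<in> detectors" and R_level: "p_FA R \<le> p"
    using R by (simp_all add: detectors_level_def)
  note [measurable] = norm_detector_in_detectors[of p]
  define \<nu> where "\<nu> = (\<lambda>z :: real ^ 'k. norm \<mu> *\<^sub>R sgn z)"
  define K where "K = (\<lambda>z y. exp (\<nu> z \<bullet> y - (norm (\<nu> z))\<^sup>2 / 2))"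
  define D where "D = (\<lambda>y :: real ^ 'k. measure (R y) {0} - measure (norm_detector p y) {0})"
  have [measurable]: "\<nu> \<in> borel_measurable borel" unfolding \<nu>_def by measurable
  have [measurable]: "D \<in> borel_measurable borel" unfolding D_def by measurable
  have K_meas [measurable]: "case_prod K \<in> borel_measurable (borel \<Otimes>\<^sub>M borel)"
    unfolding K_def by measurable
  have D_bound: "\<bar>D y\<bar> \<le> 1" for y
    using detector_accept_le_1[OF R_det, of y]
      detector_accept_le_1[OF norm_detector_in_detectors, of p y]
      measure_nonneg[of "R y" "{0}"] measure_nonneg[of "norm_detector p y" "{0}"]
    unfolding D_def by linarith
  have K_int: "integrable ?G (K z)" and K_integral: "(\<integral>y. K z y \<partial>?G) = 1" for z
    unfolding K_def by (rule integrable_likelihood_ratio integral_likelihood_ratio)+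
  \<comment> \<open>The kernel is positive with inner integral 1 for each \<open>z\<close>; since
    \<open>D\<close> is bounded, \<open>D y * K z y\<close> inherits integrability and Fubini
    applies.\<close>
  have "integrable (?G \<Otimes>\<^sub>M ?G) (case_prod K)"
  proof (rule GG.Fubini_integrable)
    have "(\<lambda>z. \<integral>y. norm (case_prod K (z, y)) \<partial>?G) = (\<lambda>_. 1)"
      using K_integral by (simp add: K_def)
    then show "integrable ?G (\<lambda>z. \<integral>y. norm (case_prod K (z, y)) \<partial>?G)" by simp
  qed (use K_int in simp_all)
  then have int: "integrable (?G \<Otimes>\<^sub>M ?G) (\<lambda>(z, y). D y * K z y)"
    by (rule Bochner_Integration.integrable_bound)
      (auto simp: abs_mult mult_left_le_one_le D_bound split_beta)
  have inner_y: "(\<integral>y. D y * K z y \<partial>?G) = p_MD R (\<nu> z) - p_MD (norm_detector p) (\<nu> z)" for z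
  proof -
    have *: "integrable ?G (\<lambda>y. measure (S y) {0} * K z y)" if S [measurable]: "S \<in> detectors"
      for S :: "real ^ 'k \<Rightarrow> nat measure"
      using K_int[of z]
      by (rule Bochner_Integration.integrable_bound)
        (auto simp: abs_mult mult_left_le_one_le detector_accept_le_1[OF S])
    show ?thesis
      unfolding p_MD_eq_integral_std_normal[OF R_det] K_def[symmetric]
        p_MD_eq_integral_std_normal[OF norm_detector_in_detectors]
      using *[OF R_det] *[OF norm_detector_in_detectors, of p]
      by (simp add: D_def left_diff_distrib K_def)
  qed
  have inner_z: "(\<integral>z. D y * K z y \<partial>?G) = D y * sphere_likelihood_ratio (norm \<mu>) y" for y
    by (simp add: K_def \<nu>_def sphere_likelihood_ratio_def)
  obtain x :: "real ^ 'k" where x: "norm x = sqrt (max 0 (chi_square_tail_inv CARD('k) p))"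
    using vector_choose_size[of "sqrt (max 0 (chi_square_tail_inv CARD('k) p))"] by auto
  have D_int: "integrable ?G D"
    by (rule G.integrable_const_bound[of _ 1]) (simp_all add: D_bound)
  \<comment> \<open>The norm detector exhausts the level, so \<open>R\<close> accepts under the null
    at least as often.\<close>
  have "0 \<le> (p_MD R 0 - p_MD (norm_detector p) (0 :: real ^ 'k)) * sphere_likelihood_ratio (norm \<mu>) x"
    using R_level p_MD_norm_detector_0[OF p, where 'k = 'k] p_FA_eq_p_MD_0[OF R_det]
    by (intro mult_nonneg_nonneg sphere_likelihood_ratio_nonneg) simp
  also have "p_MD R 0 - p_MD (norm_detector p) (0 :: real ^ 'k) = (\<integral>y. D y \<partial>?G)"
  proof -
    have "integrable ?G (\<lambda>y. measure (S y) {0})" if S [measurable]: "S \<in> detectors"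
      for S :: "real ^ 'k \<Rightarrow> nat measure"
      by (rule G.integrable_const_bound[of _ 1]) (simp_all add: detector_accept_le_1[OF S])
    then show ?thesis
      unfolding D_def by (simp add: p_MD_eq_integral R_det norm_detector_in_detectors)
  qed
  also have "(\<integral>y. D y \<partial>?G) * sphere_likelihood_ratio (norm \<mu>) x =
      (\<integral>y. D y * sphere_likelihood_ratio (norm \<mu>) x \<partial>?G)"
    by simp
  also have "\<dots> \<le> (\<integral>y. D y * sphere_likelihood_ratio (norm \<mu>) y \<partial>?G)"
  proof (rule integral_mono)
    show "integrable ?G (\<lambda>y. D y * sphere_likelihood_ratio (norm \<mu>) y)"
      using GG.integrable_snd[OF int] by (simp only: inner_z)
    show "D y * sphere_likelihood_ratio (norm \<mu>) x \<le> D y * sphere_likelihood_ratio (norm \<mu>) y" for y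
      unfolding D_def by (rule norm_detector_accept_comparison[OF R_det x])
  qed (use D_int in simp)
  \<comment> \<open>Exchanging the integrals turns the mixture likelihood ratio into an average over
    the sphere.\<close>
  also have "\<dots> = (\<integral>z. p_MD R (\<nu> z) - p_MD (norm_detector p) (\<nu> z) \<partial>?G)"
    using GG.Fubini_integral[OF int] by (simp only: inner_z inner_y)
  also have "\<dots> \<le> (\<integral>z. s - p_MD (norm_detector p) \<mu> \<partial>?G)"
  proof (rule integral_mono_AE)
    show "integrable ?G (\<lambda>z. p_MD R (\<nu> z) - p_MD (norm_detector p) (\<nu> z))"
      using GG.integrable_fst'[OF int] by (simp add: inner_y)
    \<comment> \<open>Since \<open>sgn 0 = 0\<close>, the point \<open>\<nu> z\<close> may miss the
      sphere at \<open>z = 0\<close>, hence the almost everywhere comparison.\<close>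
    have "{0} \<in> null_sets ?G"
      by (rule null_sets_normal_dist_mat_1) simp_all
    then have "AE z in ?G. z \<noteq> 0"
      using AE_not_in by fastforce
    then show "AE z in ?G. p_MD R (\<nu> z) - p_MD (norm_detector p) (\<nu> z) \<le> s - p_MD (norm_detector p) \<mu>"
    proof eventually_elim
      case (elim z)
      then have "norm (\<nu> z) = norm \<mu>" by (simp add: \<nu>_def norm_sgn)
      then show ?case
        using le[of "\<nu> z"] p_MD_norm_detector_cong[of "\<nu> z" \<mu> p] by simp
    qed
  qed simp
  also have "\<dots> = s - p_MD (norm_detector p) \<mu>"
    using G.prob_space by simp
  finally show ?thesis by simp
qed

theorem proposition1:
  fixes p :: real
  assumes "0 < p" and "p < 1"
  shows "UMM_detector p (norm_detector p :: real ^ 'k \<Rightarrow> nat measure)"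
  unfolding UMM_detector_def
proof (intro conjI allI impI ballI)
  show "norm_detector p \<in> (detectors_level p :: (real ^ 'k \<Rightarrow> nat measure) set)"
    using p_MD_norm_detector_0[OF assms, where 'k = 'k]
    by (simp add: detectors_level_def norm_detector_in_detectors p_FA_eq_p_MD_0)
next
  fix \<mu> :: "real ^ 'k" and R :: "real ^ 'k \<Rightarrow> nat measure"
  assume \<mu>: "\<mu> \<noteq> 0" and R: "R \<in> detectors_level p"
  \<comment> \<open>Suprema of reals are meaningful only for bounded nonempty sets; the set contains
    \<open>\<mu>\<close> because hardness is reflexive.\<close>
  then have bdd: "bdd_above ((\<lambda>\<nu>. p_MD R \<nu>) ` minimax_set \<mu>)"
    by (intro bdd_aboveI2[of _ _ 1] p_MD_le_1) (simp add: detectors_level_def)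
  show "(SUP \<nu>\<in>minimax_set \<mu>. p_MD (norm_detector p) \<nu>) \<le> (SUP \<nu>\<in>minimax_set \<mu>. p_MD R \<nu>)"
  proof (rule cSUP_least)
    show "minimax_set \<mu> \<noteq> {}"
      using \<mu> by (auto simp: minimax_set_def at_least_as_hard_def)
  next
    fix \<nu> assume "\<nu> \<in> minimax_set \<mu>"
    \<comment> \<open>Take \<open>s\<close> to be the supremum for \<open>R\<close>; it bounds
      \<open>R\<close> on the whole sphere through \<open>\<nu>\<close>, which lies in the minimax
      set.\<close>
    then show "p_MD (norm_detector p) \<nu> \<le> (SUP \<nu>\<in>minimax_set \<mu>. p_MD R \<nu>)"
      by (intro p_MD_norm_detector_le[OF assms R] cSUP_upper[OF _ bdd])
        (rule minimax_set_norm_invariant)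
  qed
qed

end
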